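(* Fix a model $p\in\mathcal M$, a function $\mathrm{safe}:\mathcal C\to\mathcal M$ and a prompt $x$. Let $\mathcal V=\{q_1,\dots,q_n\}$ be a cover of $\mathrm{safe}$. Let \[ d=d_x(p,\mathcal V)=\sum_{y\in\mathcal Y}\bigl|\,p(y|x)-\min\{q_1(y|x),\dots,q_n(y|x)\}\,\bigr|_+ , \] where $|t|_+=\max\{t,0\}$, and assume $d<1$. Let $\nu_k(x)$ be the probability that the sampled $y$ is accepted in a single iteration of the while loop of the algorithm (CP-$k$ or smooth-CP-$k$) run with input $p$, $\mathcal V$ and threshold $k$. Then: (1) For CP-$k$, provided $k\ge\log\bigl(2/(1-d)\bigr)$, \[ \nu_k(x)\ge\frac{1-d}{1+d}. \] (2) For smooth-CP-$k$, for $k\ge0$, \[ \nu_k(x)\ge 1-d. \]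
   Context: $\mathcal X$ is a set of prompts and $\mathcal Y$ a discrete (countable) set of outputs. A conditional generative model assigns to each $x\in\mathcal X$ a probability mass function $p(\cdot|x)$ on $\mathcal Y$; $\mathcal M$ is the set of such models. All logarithms are base 2. A set $\mathcal V=\{q_1,\dots,q_n\}\subset\mathcal M$ is a cover of $\mathrm{safe}:\mathcal C\to\mathcal M$ if for every $C\in\mathcal C$ there is $q\in\mathcal V$ with $\mathrm{safe}(C)=q$. Algorithms (input: model $p$, cover $\mathcal V$, threshold $k\ge0$). On prompt $x$, one repeatedly and independently samples $y\sim p(\cdot|x)$ until a sample is accepted, and outputs the accepted sample. - CP-$k$: accept $y$ if and only if $\log\bigl(p(y|x)/q(y|x)\bigr)\le k$ for all $q\in\mathcal V$ (the log is $+\infty$ if $q(y|x)=0$). - smooth-CP-$k$: accept $y$ with probability $\min\left\{1,\min_{q\in\mathcal V}\frac{2^kq(y|x)}{p(y|x)}\right\}$. *)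

theory Defs
  imports "HOL-Probability.Probability"
begin

type_synonym ('x, 'y) model = "'x \<Rightarrow> 'y pmf"

text \<open>A cover \<open>V = {q\<^sub>1, \<dots>, q\<^sub>n}\<close> is finite and has \<open>n \<ge> 1\<close>, so that minima over \<open>V\<close> make sense.\<close>

definition is_cover :: "'c set \<Rightarrow> ('c \<Rightarrow> ('x, 'y) model) \<Rightarrow> ('x, 'y) model set \<Rightarrow> bool" where
  "is_cover CC safe V \<longleftrightarrow> finite V \<and> V \<noteq> {} \<and> (\<forall>C\<in>CC. \<exists>q\<in>V. safe C = q)"

definition cover_dist :: "'x \<Rightarrow> ('x, 'y) model \<Rightarrow> ('x, 'y) model set \<Rightarrow> real" where
  "cover_dist x p V = (\<Sum>\<^sub>\<infinity>y\<in>UNIV. max (pmf (p x) y - Min ((\<lambda>q. pmf (q x) y) ` V)) 0)"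

text \<open>The family in \<open>cover_dist\<close> is always summable, so the sum is never a default value.\<close>

lemma cover_dist_summable:
  assumes "finite V" "V \<noteq> {}"
  shows "(\<lambda>y. max (pmf (p x) y - Min ((\<lambda>q. pmf (q x) y) ` V)) 0) summable_on UNIV"
proof (rule summable_on_comparison_test)
  show "pmf (p x) summable_on UNIV"
    using pmf_abs_summable abs_summable_summable abs_summable_equivalent by blast
  show "max (pmf (p x) y - Min ((\<lambda>q. pmf (q x) y) ` V)) 0 \<le> pmf (p x) y" for y
    using assms by (auto simp: Min_ge_iff)
qed auto

text \<open>\<open>log\<^sub>2 (a / b)\<close> with value \<open>\<infinity>\<close> for \<open>b = 0\<close>; only used for \<open>a > 0\<close>, since
  a sampled output has positive probability.\<close>

definition log_ratio :: "real \<Rightarrow> real \<Rightarrow> ereal" where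
  "log_ratio a b = (if b = 0 then \<infinity> else ereal (log 2 (a / b)))"

definition cp_accepts ::
  "('x, 'y) model \<Rightarrow> ('x, 'y) model set \<Rightarrow> real \<Rightarrow> 'x \<Rightarrow> 'y \<Rightarrow> bool" where
  "cp_accepts p V k x y \<longleftrightarrow> (\<forall>q\<in>V. log_ratio (pmf (p x) y) (pmf (q x) y) \<le> ereal k)"

definition smooth_cp_accept_prob ::
  "('x, 'y) model \<Rightarrow> ('x, 'y) model set \<Rightarrow> real \<Rightarrow> 'x \<Rightarrow> 'y \<Rightarrow> real" where
  "smooth_cp_accept_prob p V k x y =
     min 1 (Min ((\<lambda>q. 2 powr k * pmf (q x) y / pmf (p x) y) ` V))"

text \<open>One iteration of the loop of each algorithm: the joint distribution of the sampled output
  and the flag telling whether it is accepted.\<close>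

definition cp_iteration ::
  "('x, 'y) model \<Rightarrow> ('x, 'y) model set \<Rightarrow> real \<Rightarrow> 'x \<Rightarrow> ('y \<times> bool) pmf" where
  "cp_iteration p V k x =
     bind_pmf (p x) (\<lambda>y. return_pmf (y, cp_accepts p V k x y))"

definition smooth_cp_iteration ::
  "('x, 'y) model \<Rightarrow> ('x, 'y) model set \<Rightarrow> real \<Rightarrow> 'x \<Rightarrow> ('y \<times> bool) pmf" where
  "smooth_cp_iteration p V k x =
     bind_pmf (p x) (\<lambda>y.
     bind_pmf (bernoulli_pmf (smooth_cp_accept_prob p V k x y)) (\<lambda>b.
     return_pmf (y, b)))"

definition accept_prob :: "('y \<times> bool) pmf \<Rightarrow> real" where
  "accept_prob it = measure_pmf.prob it {(y, b). b}"

end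

theory Submission
  imports Defs
begin

text \<open>
  Let \<open>m\<close> be the pointwise minimum of the cover and \<open>g = max (1 - m / p) 0\<close>. Then \<open>d\<close> is the
  expectation of \<open>g\<close> under \<open>p\<close>. Smooth-CP accepts \<open>y\<close> with probability at least \<open>1 - g y\<close>,
  which gives (2). For (1), an output rejected by CP has \<open>m / p < (1 - d) / 2\<close>, hence
  \<open>g \<ge> (1 + d) / 2\<close>, and Markov's inequality bounds the rejection probability by
  \<open>2 d / (1 + d)\<close>.
\<close>

text \<open>Dividing by \<open>pmf (p x) y\<close> makes this the integrand whose mean under
  \<open>p x\<close> is \<open>d\<close>. Where that mass is 0 the quotient defaults to 0 and the
  value is 1, so the bounds 0 and 1 hold off the support too.\<close>

definition rel_deficit :: "('x, 'y) model \<Rightarrow> ('x, 'y) model set \<Rightarrow> 'x \<Rightarrow> 'y \<Rightarrow> real" where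
  "rel_deficit p V x y = max (1 - Min ((\<lambda>q. pmf (q x) y) ` V) / pmf (p x) y) 0"

lemma Min_pmf_nonneg:
  assumes "finite V" "V \<noteq> {}"
  shows "0 \<le> Min ((\<lambda>q. pmf (q x) y) ` V)"
  using assms by simp

lemma rel_deficit_bounds:
  assumes "finite V" "V \<noteq> {}"
  shows "0 \<le> rel_deficit p V x y" "rel_deficit p V x y \<le> 1"
  using Min_pmf_nonneg[OF assms, of x y] by (auto simp: rel_deficit_def)

lemma integrable_measure_pmf_unit_interval:
  fixes f :: "'a \<Rightarrow> real"
  assumes "\<And>y. 0 \<le> f y" "\<And>y. f y \<le> 1"
  shows "integrable (measure_pmf M) f"
  by (rule measure_pmf.integrable_const_bound[where B = 1]) (use assms in auto)

lemma cover_dist_eq_expectation: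
  assumes "finite V" "V \<noteq> {}"
  shows "cover_dist x p V = measure_pmf.expectation (p x) (rel_deficit p V x)"
proof -
  let ?m = "\<lambda>y. Min ((\<lambda>q. pmf (q x) y) ` V)"
  let ?h = "\<lambda>y. max (pmf (p x) y - ?m y) 0"
  have h: "pmf (p x) y * rel_deficit p V x y = ?h y" for y
  \<comment> \<open>Off the support both sides vanish: the minimum is nonnegative, so the positive
    part on the right is 0.\<close>
  proof (cases "pmf (p x) y = 0")
    case True
    then show ?thesis using Min_pmf_nonneg[OF assms, of x y] by simp
  next
    case False
    then have "pmf (p x) y * (1 - ?m y / pmf (p x) y) = pmf (p x) y - ?m y"
      by (simp add: field_simps)
    then show ?thesis
      by (simp add: rel_deficit_def max_mult_distrib_left)
  qed
  \<comment> \<open>\<open>cover_dist\<close> uses \<open>infsum\<close>, while the expectation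
    unfolds to \<open>infsetsum\<close>; absolute summability identifies the two.\<close>
  have "Infinite_Sum.abs_summable_on ?h UNIV"
    using cover_dist_summable[OF assms, of p x] by simp
  then have "infsetsum ?h UNIV = infsum ?h UNIV"
    by (intro infsetsum_infsum) (simp only: abs_summable_equivalent)
  then show ?thesis
    by (simp add: cover_dist_def pmf_expectation_eq_infsetsum h)
qed

lemma accept_prob_eq_pmf: "accept_prob it = pmf (map_pmf snd it) True"
  unfolding accept_prob_def pmf_map vimage_def
  by (simp add: case_prod_unfold)
lemma accept_prob_cp_iteration:
  "accept_prob (cp_iteration p V k x) =
     measure_pmf.expectation (p x) (\<lambda>y. of_bool (cp_accepts p V k x y))"
proof -
  have "map_pmf snd (cp_iteration p V k x) = bind_pmf (p x) (\<lambda>y. return_pmf (cp_accepts p V k x y))"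
    unfolding cp_iteration_def map_bind_pmf map_return_pmf snd_conv ..
  then show ?thesis
    unfolding accept_prob_eq_pmf by (simp only: pmf_bind pmf_return) (simp add: of_bool_def indicator_def)
qed
text \<open>These bounds ensure that \<open>bernoulli_pmf\<close> gives \<open>True\<close> exactly
  the mass of its parameter, without truncation to the unit interval.\<close>

lemma smooth_cp_accept_prob_bounds:
  assumes "finite V" "V \<noteq> {}"
  shows "0 \<le> smooth_cp_accept_prob p V k x y" "smooth_cp_accept_prob p V k x y \<le> 1"
  using assms by (auto simp: smooth_cp_accept_prob_def)
lemma accept_prob_smooth_cp_iteration:
  assumes "finite V" "V \<noteq> {}"
  shows "accept_prob (smooth_cp_iteration p V k x) =
     measure_pmf.expectation (p x) (smooth_cp_accept_prob p V k x)"
proof -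
  have "map_pmf snd (smooth_cp_iteration p V k x) =
      bind_pmf (p x) (\<lambda>y. bernoulli_pmf (smooth_cp_accept_prob p V k x y))"
    unfolding smooth_cp_iteration_def map_bind_pmf map_return_pmf snd_conv bind_return_pmf' ..
  then show ?thesis
    unfolding accept_prob_eq_pmf
    by (simp add: pmf_bind smooth_cp_accept_prob_bounds[OF assms])
qed

text \<open>A rejecting \<open>q\<close> has likelihood ratio p/q above 2 / (1 - d); inverting it
  and using that the minimum is at most \<open>q\<close> leaves a deficit of at least 1 - (1 - d) /
  2.\<close>

lemma rel_deficit_ge_if_not_cp_accepts:
  assumes V: "finite V" "V \<noteq> {}"
    and "d < 1" "k \<ge> log 2 (2 / (1 - d))"
    and y: "y \<in> set_pmf (p x)" and rejected: "\<not> cp_accepts p V k x y"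
  shows "(1 + d) / 2 \<le> rel_deficit p V x y"
proof -
  have p0: "pmf (p x) y > 0"
    using y by (simp add: pmf_positive)
  obtain q where q: "q \<in> V" "\<not> log_ratio (pmf (p x) y) (pmf (q x) y) \<le> ereal k"
    using rejected by (auto simp: cp_accepts_def)
  have "pmf (q x) y / pmf (p x) y \<le> (1 - d) / 2"
  \<comment> \<open>Here \<open>log_ratio\<close> is infinite and cannot be compared through
    \<open>log\<close>, but q/p is simply 0.\<close>
  proof (cases "pmf (q x) y = 0")
    case True
    then show ?thesis using \<open>d < 1\<close> by simp
  next
    case False
    then have q0: "pmf (q x) y > 0" by (simp add: pmf_nonneg less_le)
    have "log 2 (2 / (1 - d)) < log 2 (pmf (p x) y / pmf (q x) y)"
      using q(2) False assms(4) by (simp add: log_ratio_def)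
    then have "2 / (1 - d) < pmf (p x) y / pmf (q x) y"
      using p0 q0 \<open>d < 1\<close> by simp
    then show ?thesis
      using p0 q0 \<open>d < 1\<close> by (simp add: field_simps)
  qed
  moreover have "Min ((\<lambda>q. pmf (q x) y) ` V) \<le> pmf (q x) y"
    using q(1) V by simp
  then have "Min ((\<lambda>q. pmf (q x) y) ` V) / pmf (p x) y \<le> pmf (q x) y / pmf (p x) y"
    using p0 by (simp add: divide_right_mono)
  ultimately have "(1 + d) / 2 \<le> 1 - Min ((\<lambda>q. pmf (q x) y) ` V) / pmf (p x) y"
    by argo
  then show ?thesis
    unfolding rel_deficit_def by (rule max.coboundedI1)
qed

text \<open>The factor \<open>2 powr k\<close> is at least 1, so each scaled ratio dominates the
  unscaled minimum.\<close>

lemma smooth_cp_accept_prob_ge: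
  assumes V: "finite V" "V \<noteq> {}" and "k \<ge> 0"
  shows "1 - rel_deficit p V x y \<le> smooth_cp_accept_prob p V k x y"
proof -
  let ?m = "Min ((\<lambda>q. pmf (q x) y) ` V)"
  have "?m / pmf (p x) y \<le> 2 powr k * pmf (q x) y / pmf (p x) y" if "q \<in> V" for q
  proof (rule divide_right_mono)
    have "?m \<le> 1 * pmf (q x) y"
      using that V by simp
    also have "\<dots> \<le> 2 powr k * pmf (q x) y"
      using \<open>k \<ge> 0\<close> by (intro mult_right_mono) (auto simp: ge_one_powr_ge_zero)
    finally show "?m \<le> 2 powr k * pmf (q x) y" .
  qed simp
  then have "?m / pmf (p x) y \<le> Min ((\<lambda>q. 2 powr k * pmf (q x) y / pmf (p x) y) ` V)"
    using V by simp
  then show ?thesis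
    unfolding smooth_cp_accept_prob_def rel_deficit_def by linarith
qed

theorem theorem3p6:
  fixes p :: "'x \<Rightarrow> ('y :: countable) pmf"
    and CC :: "'c set"
    and safe :: "'c \<Rightarrow> 'x \<Rightarrow> 'y pmf"
    and x :: 'x
    and V :: "('x \<Rightarrow> 'y pmf) set"
    and d :: real
  assumes "is_cover CC safe V"
    and "d = cover_dist x p V"
    and "d < 1"
  shows "(\<forall>k::real. k \<ge> log 2 (2 / (1 - d)) \<longrightarrow>
            accept_prob (cp_iteration p V k x) \<ge> (1 - d) / (1 + d)) \<and>
         (\<forall>k::real. k \<ge> 0 \<longrightarrow>
            accept_prob (smooth_cp_iteration p V k x) \<ge> 1 - d)"
proof (intro conjI allI impI)
  let ?E = "measure_pmf.expectation (p x)"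
  let ?g = "rel_deficit p V x"
  have V: "finite V" "V \<noteq> {}"
    using assms(1) by (auto simp: is_cover_def)
  have d: "d = ?E ?g"
    using assms(2) cover_dist_eq_expectation[OF V] by simp
  have g: "integrable (measure_pmf (p x)) ?g"
    by (intro integrable_measure_pmf_unit_interval rel_deficit_bounds[OF V])
  have "d \<ge> 0"
    unfolding d by (intro integral_nonneg_AE) (simp add: rel_deficit_bounds[OF V])

  fix k :: real
  {
    assume k: "k \<ge> log 2 (2 / (1 - d))"
    let ?a = "\<lambda>y. of_bool (cp_accepts p V k x y) :: real"
    have a: "integrable (measure_pmf (p x)) ?a"
      by (rule integrable_measure_pmf_unit_interval) auto
    \<comment> \<open>Markov's inequality in integrated form: the left integrand is 0 on accepted
      outputs and (1 + d) / 2 on rejected ones.\<close>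
    have "?E (\<lambda>y. (1 + d) / 2 * (1 - ?a y)) \<le> ?E ?g"
    proof (rule integral_mono_AE)
      show "AE y in measure_pmf (p x). (1 + d) / 2 * (1 - ?a y) \<le> ?g y"
        using rel_deficit_ge_if_not_cp_accepts[OF V \<open>d < 1\<close> k] rel_deficit_bounds[OF V]
        by (auto simp: AE_measure_pmf_iff)
    qed (use a g in auto)
    then have "(1 + d) / 2 * (1 - accept_prob (cp_iteration p V k x)) \<le> d"
      using a by (simp add: d[symmetric] accept_prob_cp_iteration)
    \<comment> \<open>Since 1 + d > 0, division is safe, and 1 - 2 d / (1 + d) is the claimed
      bound.\<close>
    then show "(1 - d) / (1 + d) \<le> accept_prob (cp_iteration p V k x)"
      using \<open>d \<ge> 0\<close> by (simp add: field_simps)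
  }
  {
    assume k: "k \<ge> 0"
    have "?E (\<lambda>y. 1 - ?g y) \<le> ?E (smooth_cp_accept_prob p V k x)"
      using g by (intro integral_mono smooth_cp_accept_prob_ge[OF V k]
          integrable_measure_pmf_unit_interval smooth_cp_accept_prob_bounds[OF V])
        (simp_all add: rel_deficit_bounds[OF V])
    then show "1 - d \<le> accept_prob (smooth_cp_iteration p V k x)"
      using g by (simp add: d accept_prob_smooth_cp_iteration[OF V])
  }
qed

end
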